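(* Let $P$ be a poset and let $\to$ be a total binary operation on $P$. Then $$x\to y=\max\{u\ge y: u\perp_y x\}\quad\text{for all }x,y\in P$$ (i.e. for all $x,y$ this maximum exists and equals $x\to y$) if and only if the following conditions hold for all $x,y,z\in P$: (1) if $x\le y$, then $y\to z\le x\to z$; (2) if $y\le x\le x\to y$, then $x\le y$; (3) if $z\le x$ and $x\perp_z y$, then $x\le y\to z$.
   Context: For elements of a poset $P$, $[p,q]=\{x: p\le x\le q\}$ (empty if $p\not\le q$). For $x,y,p\in P$, $x\perp_p y$ means $[p,x]\cap[p,y]\subseteq\{p\}$. Here $\max$ denotes the greatest element of a set. *)

theory Defs
  imports Main
begin

definition perp_at :: "'a::order \<Rightarrow> 'a \<Rightarrow> 'a \<Rightarrow> bool" where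
  "perp_at p x y \<longleftrightarrow> {p..x} \<inter> {p..y} \<subseteq> {p}"

(* Greatest is a definite description, unspecified when there is no greatest
   element; the relation below also asserts that the maximum exists. *)
definition is_greatest :: "'a::order set \<Rightarrow> 'a \<Rightarrow> bool" where
  "is_greatest S m \<longleftrightarrow> m \<in> S \<and> (\<forall>u\<in>S. u \<le> m)"

end

theory Submission imports Defs begin

text \<open>Condition (3) is exactly the upper-bound half of the maximum. Membership of
  \<open>imp x y\<close> in the set corresponds to (1) and (2): shrinking \<open>x\<close> shrinks
  the interval \<open>{z..x}\<close>, so more elements qualify, and a common element of the two
  intervals can be tested against its own implication.\<close>

theorem theorem5p3:
  fixes imp :: "'a::order \<Rightarrow> 'a \<Rightarrow> 'a"
  shows "(\<forall>x y. is_greatest {u. y \<le> u \<and> perp_at y u x} (imp x y)) \<longleftrightarrow>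
    (\<forall>x y z.
       (x \<le> y \<longrightarrow> imp y z \<le> imp x z) \<and>
       (y \<le> x \<and> x \<le> imp x y \<longrightarrow> x \<le> y) \<and>
       (z \<le> x \<and> perp_at z x y \<longrightarrow> x \<le> imp y z))"
    (is "?L \<longleftrightarrow> ?R")
proof
  assume ?L
  then have ge: "y \<le> imp x y" and perp: "perp_at y (imp x y) x"
    and greatest: "\<And>u. y \<le> u \<Longrightarrow> perp_at y u x \<Longrightarrow> u \<le> imp x y" for x y
    by (auto simp: is_greatest_def)
  have "imp y z \<le> imp x z" if "x \<le> y" for x y z
  proof (rule greatest[OF ge])
    \<comment> \<open>\<open>{z..x}\<close> is contained in \<open>{z..y}\<close>, so orthogonality
      to \<open>y\<close> passes to \<open>x\<close>.\<close>
    show "perp_at z (imp y z) x"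
      using perp[of z y] that by (fastforce simp: perp_at_def)
  qed
  moreover have "x \<le> y" if "y \<le> x" "x \<le> imp x y" for x y
    \<comment> \<open>\<open>x\<close> itself lies in both intervals, hence equals
      \<open>y\<close>.\<close>
    using perp[of y x] that by (auto simp: perp_at_def)
  ultimately show ?R
    using greatest by blast
next
  assume ?R
  then have antimono: "x \<le> y \<Longrightarrow> imp y z \<le> imp x z"
    and collapse: "y \<le> x \<Longrightarrow> x \<le> imp x y \<Longrightarrow> x \<le> y"
    and greatest: "z \<le> x \<Longrightarrow> perp_at z x y \<Longrightarrow> x \<le> imp y z" for x y z
    by blast+
  have "y \<le> imp x y" for x y
    \<comment> \<open>The candidate is \<open>y\<close> itself, as \<open>{y..y}\<close> is a
      singleton.\<close>
    by (rule greatest) (auto simp: perp_at_def)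
  moreover have "perp_at y (imp x y) x" for x y
    unfolding perp_at_def
  proof
    fix w
    assume "w \<in> {y..imp x y} \<inter> {y..x}"
    then have w: "y \<le> w" "w \<le> imp x y" "w \<le> x"
      by auto
    \<comment> \<open>Antitonicity replaces \<open>x\<close> by the smaller \<open>w\<close>, giving
      the self-referential form that \<open>collapse\<close> requires.\<close>
    have "w \<le> imp w y"
      using w(2) antimono[OF w(3)] by (rule order_trans)
    then have "w \<le> y"
      by (rule collapse[OF w(1)])
    with w(1) show "w \<in> {y}"
      by simp
  qed
  ultimately show ?L
    using greatest by (simp add: is_greatest_def)
qed

end
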